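(* Let $K$ be a closed and convex cone in $L_p(S;X)$ with vertex at $v\in L_p(S;X)$. For any $\varphi\in L_q(S;X^* )$: (a) if $g\in\mathcal{S}_K(\varphi)$, then $\varphi\perp(g-v)$; that is, $\langle\varphi,g\rangle=\langle\varphi,v\rangle$ for any $g\in\mathcal{S}_K(\varphi)$; (b) if $\mathcal{S}_K(\varphi)\neq\emptyset$, then $v\in\mathcal{S}_K(\varphi)$; (c) if there is $g\in\mathcal{S}_K(\varphi)$ with $g\neq v$, then $\mathcal{S}_K(\varphi)$ is a closed and convex cone in $L_p(S;X)$ contained in $K$, with the same vertex $v$; (d) if $\mathcal{S}_K(\varphi)\neq\emptyset$, then $\varphi\perp(\mathcal{S}_K(\varphi)-v)$; in particular, if $v=\theta$, then $\varphi\perp\mathcal{S}_K(\varphi)$ for any $\varphi\in L_q(S;X^* )$ with $\mathcal{S}_K(\varphi)\neq\emptyset$; (e) $\bigcap\{\mathcal{S}_K(\psi):\psi\in L_q(S;X^* )\text{ with }\mathcal{S}_K(\psi)\neq\emptyset\}\neq\emptyset$, and $v\in\bigcap\{\mathcal{S}_K(\psi):\psi\in L_q(S;X^* )\text{ with }\mathcal{S}_K(\psi)\neq\emptyset\}$.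
   Context: Setting: $(S,\mathcal{A},\mu)$ is a positive complete measure space, $(X,\|\cdot\|_X)$ is a real uniformly convex and uniformly smooth Banach space with dual $X^*$, and $1<p,q<\infty$ with $\frac1p+\frac1q=1$. $L_p(S;X)$ is the Bochner space of ($\mu$-equivalence classes of) strongly $\mu$-measurable $f:S\to X$ with $\|f\|_{L_p(S;X)}=\left(\int_S\|f(s)\|_X^p\,d\mu(s)\right)^{1/p}<\infty$; it is uniformly convex and uniformly smooth with dual $L_q(S;X^* )$ under the pairing $\langle\varphi,f\rangle=\int_S\langle\varphi(s),f(s)\rangle\,d\mu(s)$. The origin of $L_p(S;X)$ is $\theta$. A cone with vertex at $v$ is a nonempty set $K$ with $v\in K$ such that $v+t(g-v)\in K$ for all $g\in K$ and $t\ge0$. For a nonempty closed convex $C\subseteq L_p(S;X)$ and $\varphi\in L_q(S;X^* )$, the solution set is $$\mathcal{S}_C(\varphi)=\left\{g\in C:\ \int_S\langle\varphi(s),g(s)\rangle\,d\mu(s)=\sup_{f\in C}\int_S\langle\varphi(s),f(s)\rangle\,d\mu(s)\right\}.$$ $\varphi\perp f$ means $\langle\varphi,f\rangle=0$; for a nonempty set $A\subseteq L_p(S;X)$, $\varphi\perp A$ means $\varphi\perp f$ for every $f\in A$; $A-v=\{f-v:f\in A\}$. *)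

theory Defs
  imports "HOL-Analysis.Analysis"
begin

section \<open>Geometry of the value space\<close>

definition uniformly_convex :: "'x::real_normed_vector itself \<Rightarrow> bool" where
  "uniformly_convex _ \<longleftrightarrow>
     (\<forall>\<epsilon>>0. \<exists>\<delta>>0. \<forall>x y :: 'x. norm x = 1 \<longrightarrow> norm y = 1 \<longrightarrow> \<epsilon> \<le> norm (x - y) \<longrightarrow>
        norm ((1/2) *\<^sub>R (x + y)) \<le> 1 - \<delta>)"

text \<open>The modulus of smoothness \<open>\<rho>(t)\<close> is the supremum of
  \<open>(norm (x + t y) + norm (x - t y)) / 2 - 1\<close> over unit vectors \<open>x\<close>, \<open>y\<close>; the condition below
  says that \<open>\<rho>(t) / t\<close> tends to 0 as \<open>t\<close> decreases to 0.\<close>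

definition uniformly_smooth :: "'x::real_normed_vector itself \<Rightarrow> bool" where
  "uniformly_smooth _ \<longleftrightarrow>
     (\<forall>\<epsilon>>0. \<exists>\<delta>>0. \<forall>t x y. 0 < t \<longrightarrow> t < \<delta> \<longrightarrow> norm (x::'x) = 1 \<longrightarrow> norm (y::'x) = 1 \<longrightarrow>
        (norm (x + t *\<^sub>R y) + norm (x - t *\<^sub>R y)) / 2 - 1 \<le> \<epsilon> * t)"

section \<open>Bochner spaces\<close>

text \<open>The Bochner integral of the library is restricted to second countable value spaces. For an
  arbitrary Banach space, strong measurability is defined as almost everywhere approximability by
  simple functions that vanish outside a set of finite measure.\<close>

definition strongly_measurable :: "'s measure \<Rightarrow> ('s \<Rightarrow> 'x::real_normed_vector) \<Rightarrow> bool" where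
  "strongly_measurable M f \<longleftrightarrow>
     (\<exists>u :: nat \<Rightarrow> 's \<Rightarrow> 'x. (\<forall>n. simple_function M (u n) \<and> emeasure M {s \<in> space M. u n s \<noteq> 0} < \<infinity>) \<and>
        (AE s in M. (\<lambda>n. u n s) \<longlonglongrightarrow> f s))"

definition Lp_fun :: "'s measure \<Rightarrow> real \<Rightarrow> ('s \<Rightarrow> 'x::real_normed_vector) set" where
  "Lp_fun M p = {f. strongly_measurable M f \<and> integrable M (\<lambda>s. norm (f s) powr p)}"

definition Lp_rel :: "'s measure \<Rightarrow> real \<Rightarrow> (('s \<Rightarrow> 'x::real_normed_vector) \<times> ('s \<Rightarrow> 'x)) set" where
  "Lp_rel M p = {(f, g). f \<in> Lp_fun M p \<and> g \<in> Lp_fun M p \<and> (AE s in M. f s = g s)}"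

definition Lp :: "'s measure \<Rightarrow> real \<Rightarrow> ('s \<Rightarrow> 'x::real_normed_vector) set set" where
  "Lp M p = Lp_fun M p // Lp_rel M p"

definition Lp_class :: "'s measure \<Rightarrow> real \<Rightarrow> ('s \<Rightarrow> 'x::real_normed_vector) \<Rightarrow> ('s \<Rightarrow> 'x) set" where
  "Lp_class M p f = Lp_rel M p `` {f}"

text \<open>Operations on classes are computed on an arbitrary representative; the result does not depend
  on the choice.\<close>

definition Lp_rep :: "('s \<Rightarrow> 'x) set \<Rightarrow> 's \<Rightarrow> 'x" where
  "Lp_rep F = (SOME f. f \<in> F)"

definition Lp_zero :: "'s measure \<Rightarrow> real \<Rightarrow> ('s \<Rightarrow> 'x::real_normed_vector) set" where
  "Lp_zero M p = Lp_class M p (\<lambda>s. 0)"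

definition Lp_add :: "'s measure \<Rightarrow> real \<Rightarrow> ('s \<Rightarrow> 'x::real_normed_vector) set \<Rightarrow> ('s \<Rightarrow> 'x) set \<Rightarrow> ('s \<Rightarrow> 'x) set" where
  "Lp_add M p F G = Lp_class M p (\<lambda>s. Lp_rep F s + Lp_rep G s)"

definition Lp_diff :: "'s measure \<Rightarrow> real \<Rightarrow> ('s \<Rightarrow> 'x::real_normed_vector) set \<Rightarrow> ('s \<Rightarrow> 'x) set \<Rightarrow> ('s \<Rightarrow> 'x) set" where
  "Lp_diff M p F G = Lp_class M p (\<lambda>s. Lp_rep F s - Lp_rep G s)"

definition Lp_scale :: "'s measure \<Rightarrow> real \<Rightarrow> real \<Rightarrow> ('s \<Rightarrow> 'x::real_normed_vector) set \<Rightarrow> ('s \<Rightarrow> 'x) set" where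
  "Lp_scale M p t F = Lp_class M p (\<lambda>s. t *\<^sub>R Lp_rep F s)"

definition Lp_norm :: "'s measure \<Rightarrow> real \<Rightarrow> ('s \<Rightarrow> 'x::real_normed_vector) set \<Rightarrow> real" where
  "Lp_norm M p F = (\<integral>s. norm (Lp_rep F s) powr p \<partial>M) powr (1 / p)"

definition Lp_dist :: "'s measure \<Rightarrow> real \<Rightarrow> ('s \<Rightarrow> 'x::real_normed_vector) set \<Rightarrow> ('s \<Rightarrow> 'x) set \<Rightarrow> real" where
  "Lp_dist M p F G = Lp_norm M p (Lp_diff M p F G)"

text \<open>The distance is a metric, so the locale constant \<open>mtopology\<close> used for the norm topology has
  its intended meaning. The facts \<open>Lp_fun_comb\<close> and \<open>AE_Lp_rep_class\<close> show that the operations on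
  classes are well defined.\<close>

lemma strongly_measurable_compose2:
  assumes "strongly_measurable M f" "strongly_measurable M g"
    and h: "h 0 0 = 0" "continuous_on UNIV (\<lambda>z. h (fst z) (snd z))"
  shows "strongly_measurable M (\<lambda>s. h (f s) (g s))"
proof -
  from assms obtain u w where
    u: "\<And>n. simple_function M (u n)" "\<And>n. emeasure M {s \<in> space M. u n s \<noteq> 0} < \<infinity>"
       "AE s in M. (\<lambda>n. u n s) \<longlonglongrightarrow> f s" and
    w: "\<And>n. simple_function M (w n)" "\<And>n. emeasure M {s \<in> space M. w n s \<noteq> 0} < \<infinity>"
       "AE s in M. (\<lambda>n. w n s) \<longlonglongrightarrow> g s"
    unfolding strongly_measurable_def by blast
  have "emeasure M {s \<in> space M. h (u n s) (w n s) \<noteq> 0} < \<infinity>" for n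
  proof -
    have sets: "{s \<in> space M. u n s \<noteq> 0} \<in> sets M" "{s \<in> space M. w n s \<noteq> 0} \<in> sets M"
      using simple_functionD(2)[OF u(1)[of n], of "- {0}"] simple_functionD(2)[OF w(1)[of n], of "- {0}"]
      by (auto simp: vimage_def Int_def conj_commute)
    have "emeasure M {s \<in> space M. h (u n s) (w n s) \<noteq> 0}
        \<le> emeasure M ({s \<in> space M. u n s \<noteq> 0} \<union> {s \<in> space M. w n s \<noteq> 0})"
      by (rule emeasure_mono) (use sets in \<open>auto simp: h\<close>)
    also have "\<dots> \<le> emeasure M {s \<in> space M. u n s \<noteq> 0} + emeasure M {s \<in> space M. w n s \<noteq> 0}"
      by (rule emeasure_subadditive) (use sets in auto)
    also have "\<dots> < \<infinity>" using u(2)[of n] w(2)[of n] by (simp add: ennreal_add_less_top)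
    finally show ?thesis .
  qed
  moreover have "simple_function M (\<lambda>s. h (u n s) (w n s))" for n
    using simple_function_compose2[OF u(1) w(1)] .
  moreover have "AE s in M. (\<lambda>n. h (u n s) (w n s)) \<longlonglongrightarrow> h (f s) (g s)"
    using u(3) w(3)
  proof eventually_elim
    case (elim s)
    have "isCont (\<lambda>z. h (fst z) (snd z)) (f s, g s)"
      using h(2) by (simp add: continuous_on_eq_continuous_at)
    from isCont_tendsto_compose[OF this tendsto_Pair[OF elim]] show ?case by simp
  qed
  ultimately show ?thesis
    unfolding strongly_measurable_def by (intro exI[of _ "\<lambda>n s. h (u n s) (w n s)"]) auto
qed

lemma borel_measurable_AE_complete:
  fixes f g :: "'s \<Rightarrow> real"
  assumes "complete_measure M" "f \<in> borel_measurable M" "AE s in M. f s = g s"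
  shows "g \<in> borel_measurable M"
proof (rule measurableI)
  interpret complete_measure M by fact
  fix A :: "real set" assume A: "A \<in> sets borel"
  have "f -` A \<inter> space M \<in> sets M" using assms(2) A by (rule measurable_sets)
  moreover have "AE s in M. (s \<in> f -` A \<inter> space M) \<longleftrightarrow> s \<in> g -` A \<inter> space M"
    using assms(3) by eventually_elim auto
  ultimately show "g -` A \<inter> space M \<in> sets M"
    using in_sets_AE[of "f -` A \<inter> space M" "g -` A \<inter> space M"] by blast
qed simp

lemma strongly_measurable_norm:
  assumes "complete_measure M" "strongly_measurable M f"
  shows "(\<lambda>s. norm (f s)) \<in> borel_measurable M"
proof -
  from assms obtain u where
    u: "\<And>n. simple_function M (u n)" "AE s in M. (\<lambda>n. u n s) \<longlonglongrightarrow> f s"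
    unfolding strongly_measurable_def by blast
  have [measurable]: "(\<lambda>s. norm (u n s)) \<in> borel_measurable M" for n
    by (intro borel_measurable_simple_function simple_function_compose1[OF u(1)])
  have "(\<lambda>s. lim (\<lambda>n. norm (u n s))) \<in> borel_measurable M"
    by measurable
  moreover have "AE s in M. lim (\<lambda>n. norm (u n s)) = norm (f s)"
    using u(2) by eventually_elim (auto intro!: limI tendsto_norm)
  ultimately show ?thesis by (rule borel_measurable_AE_complete[OF assms(1)])
qed

lemma powr_add_le: 
  assumes "0 \<le> (a::real)" "0 \<le> b" "0 < p"
  shows "(a + b) powr p \<le> 2 powr p * (a powr p + b powr p)"
proof -
  have "(a + b) powr p \<le> (2 * max a b) powr p"
    using assms by (intro powr_mono2) auto
  also have "\<dots> = 2 powr p * max a b powr p" using assms by (intro powr_mult)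
  also have "max a b powr p \<le> a powr p + b powr p"
    by (cases "a \<le> b") (simp_all add: max_absorb1 max_absorb2)
  finally show ?thesis by simp
qed

lemma Lp_fun_comb:
  assumes M: "complete_measure M" and p: "0 < p" and f: "f \<in> Lp_fun M p" and g: "g \<in> Lp_fun M p"
  shows "(\<lambda>s. a *\<^sub>R f s + b *\<^sub>R g s) \<in> Lp_fun M p"
proof -
  let ?h = "\<lambda>s. a *\<^sub>R f s + b *\<^sub>R g s"
  have sm: "strongly_measurable M ?h"
    using f g by (intro strongly_measurable_compose2[where h="\<lambda>x y. a *\<^sub>R x + b *\<^sub>R y"])
      (auto simp: Lp_fun_def intro!: continuous_intros)
  have "integrable M (\<lambda>s. norm (?h s) powr p)"
  proof (rule Bochner_Integration.integrable_bound)
    show "integrable M (\<lambda>s. 2 powr p * (\<bar>a\<bar> powr p * norm (f s) powr p + \<bar>b\<bar> powr p * norm (g s) powr p))"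
      using f g by (auto simp: Lp_fun_def)
    show "(\<lambda>s. norm (?h s) powr p) \<in> borel_measurable M"
      using strongly_measurable_norm[OF M sm] by measurable
    show "AE s in M. norm (norm (?h s) powr p) \<le> norm (2 powr p * (\<bar>a\<bar> powr p * norm (f s) powr p + \<bar>b\<bar> powr p * norm (g s) powr p))"
    proof (rule AE_I2)
      fix s
      have "norm (?h s) powr p \<le> (\<bar>a\<bar> * norm (f s) + \<bar>b\<bar> * norm (g s)) powr p"
        using p by (intro powr_mono2) (auto intro: norm_triangle_le)
      also have "\<dots> \<le> 2 powr p * ((\<bar>a\<bar> * norm (f s)) powr p + (\<bar>b\<bar> * norm (g s)) powr p)"
        using p by (intro powr_add_le) auto
      finally show "norm (norm (?h s) powr p) \<le> norm (2 powr p * (\<bar>a\<bar> powr p * norm (f s) powr p + \<bar>b\<bar> powr p * norm (g s) powr p))"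
        by (simp add: powr_mult)
    qed
  qed
  with sm show ?thesis by (simp add: Lp_fun_def)
qed

lemma Lp_fun_zero: "p > 0 \<Longrightarrow> (\<lambda>s. 0) \<in> Lp_fun M p"
  by (auto simp: Lp_fun_def strongly_measurable_def intro!: exI[of _ "\<lambda>_ _. 0"])

lemma equiv_Lp_rel: "equiv (Lp_fun M p) (Lp_rel M p)"
  by (rule equivI) (auto simp: Lp_rel_def refl_on_def sym_def trans_def elim: eventually_elim2)

lemma Lp_class_eq_iff:
  assumes "f \<in> Lp_fun M p" "g \<in> Lp_fun M p"
  shows "Lp_class M p f = Lp_class M p g \<longleftrightarrow> (AE s in M. f s = g s)"
  using equiv_Lp_rel[of M p] eq_equiv_class_iff[OF equiv_Lp_rel assms] assms
  by (auto simp: Lp_class_def Lp_rel_def)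

lemma Lp_class_in: "f \<in> Lp_fun M p \<Longrightarrow> Lp_class M p f \<in> Lp M p"
  by (simp add: Lp_class_def Lp_def quotientI)

lemma Lp_rep_in: 
  assumes "F \<in> Lp M p" shows "Lp_rep F \<in> Lp_fun M p" "Lp_class M p (Lp_rep F) = F"
proof -
  from assms obtain f where f: "f \<in> Lp_fun M p" "F = Lp_rel M p `` {f}"
    by (auto simp: Lp_def elim: quotientE)
  then have "f \<in> F" using equiv_class_self[OF equiv_Lp_rel] by blast
  then have "Lp_rep F \<in> F" unfolding Lp_rep_def by (rule someI[of "\<lambda>f. f \<in> F"])
  then have r: "(f, Lp_rep F) \<in> Lp_rel M p" using f by simp
  then show "Lp_rep F \<in> Lp_fun M p" by (simp add: Lp_rel_def)
  show "Lp_class M p (Lp_rep F) = F"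
    using equiv_class_eq[OF equiv_Lp_rel r] f by (simp add: Lp_class_def)
qed

lemma AE_Lp_rep_class:
  assumes "f \<in> Lp_fun M p" shows "AE s in M. Lp_rep (Lp_class M p f) s = f s"
  using Lp_rep_in[OF Lp_class_in[OF assms]] assms Lp_class_eq_iff by blast

lemma Lp_norm_class:
  assumes M: "complete_measure M" and f: "f \<in> Lp_fun M p" 
  shows "Lp_norm M p (Lp_class M p f) = (\<integral>s. norm (f s) powr p \<partial>M) powr (1/p)"
proof -
  have r: "Lp_rep (Lp_class M p f) \<in> Lp_fun M p" using Lp_rep_in Lp_class_in f by blast
  have "(\<integral>s. norm (Lp_rep (Lp_class M p f) s) powr p \<partial>M) = (\<integral>s. norm (f s) powr p \<partial>M)"
    using AE_Lp_rep_class[OF f] f r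
    by (intro integral_cong_AE) (auto simp: Lp_fun_def)
  then show ?thesis by (simp add: Lp_norm_def)
qed

lemma powr_convex0:
  fixes x y a b p :: real
  assumes "1 \<le> p" "0 \<le> x" "0 \<le> y" "0 < a" "0 < b" "a + b = 1"
  shows "(a * x + b * y) powr p \<le> a * x powr p + b * y powr p"
proof -
  have le: "c powr p \<le> c" if "0 < c" "c \<le> 1" for c :: real
    using powr_mono'[of 1 p c] that assms by simp
  show ?thesis
  proof (cases "x = 0 \<or> y = 0")
    case True
    with assms show ?thesis using le[of a] le[of b]
      by (auto simp: powr_mult intro!: mult_right_mono)
  next
    case False
    with assms show ?thesis
      using convex_onD[OF powr_convex[OF assms(1)], of b x y]
      by (simp add: eq_diff_eq[symmetric])
  qed
qed

lemma Minkowski_Lp_fun: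
  assumes M: "complete_measure M" and p: "1 < p" and f: "f \<in> Lp_fun M p" and g: "g \<in> Lp_fun M p"
  shows "(\<integral>s. norm (f s + g s) powr p \<partial>M) powr (1/p)
     \<le> (\<integral>s. norm (f s) powr p \<partial>M) powr (1/p) + (\<integral>s. norm (g s) powr p \<partial>M) powr (1/p)"
proof -
  define A where "A = (\<integral>s. norm (f s) powr p \<partial>M) powr (1/p)"
  define B where "B = (\<integral>s. norm (g s) powr p \<partial>M) powr (1/p)"
  have AB: "A \<ge> 0" "B \<ge> 0" by (auto simp: A_def B_def)
  have fi: "integrable M (\<lambda>s. norm (f s) powr p)" and gi: "integrable M (\<lambda>s. norm (g s) powr p)"
    using f g by (auto simp: Lp_fun_def)
  have hi: "integrable M (\<lambda>s. norm (f s + g s) powr p)"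
    using Lp_fun_comb[OF M _ f g, of 1 1] p by (auto simp: Lp_fun_def)
  have Ap: "(\<integral>s. norm (f s) powr p \<partial>M) = A powr p" and Bp: "(\<integral>s. norm (g s) powr p \<partial>M) = B powr p"
    using p by (auto simp: A_def B_def powr_powr)
  have *: "(\<integral>s. norm (f s + g s) powr p \<partial>M) \<le> (a + b) powr p" if ab: "A < a" "B < b" for a b
  proof -
    have pos: "a > 0" "b > 0" using ab AB by auto
    have sum1: "a / (a + b) + b / (a + b) = 1"
      using pos by (subst add_divide_distrib[symmetric]) simp
    have "(\<integral>s. norm (f s + g s) powr p \<partial>M)
       \<le> (\<integral>s. (a + b) powr p * (a / (a + b) * (norm (f s) powr p / a powr p) + b / (a + b) * (norm (g s) powr p / b powr p)) \<partial>M)"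
    proof (rule integral_mono[OF hi])
      fix s
      have "norm (f s + g s) powr p \<le> (norm (f s) + norm (g s)) powr p"
        using p by (intro powr_mono2) (auto intro: norm_triangle_ineq)
      also have "\<dots> = ((a + b) * (a / (a + b) * (norm (f s) / a) + b / (a + b) * (norm (g s) / b))) powr p"
      proof -
        have "(a + b) * (a / (a + b) * (x / a) + b / (a + b) * (y / b)) = x + y" for x y
          using pos by (simp add: distrib_left)
        then show ?thesis by simp
      qed
      also have "\<dots> = (a + b) powr p * (a / (a + b) * (norm (f s) / a) + b / (a + b) * (norm (g s) / b)) powr p"
        using pos by (intro powr_mult)
      also have "\<dots> \<le> (a + b) powr p * (a / (a + b) * (norm (f s) / a) powr p + b / (a + b) * (norm (g s) / b) powr p)"
        using pos p by (intro mult_left_mono powr_convex0 sum1) auto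
      finally show "norm (f s + g s) powr p \<le> (a + b) powr p * (a / (a + b) * (norm (f s) powr p / a powr p) + b / (a + b) * (norm (g s) powr p / b powr p))"
        using pos by (simp add: powr_divide)
    qed (use fi gi in auto)
    also have "\<dots> = (a + b) powr p * (a / (a + b) * (A powr p / a powr p) + b / (a + b) * (B powr p / b powr p))"
      using fi gi by (simp add: Ap Bp)
    also have "\<dots> \<le> (a + b) powr p * (a / (a + b) * 1 + b / (a + b) * 1)"
      using pos ab AB p by (intro mult_left_mono add_mono) (auto intro!: powr_mono2)
    also have "\<dots> = (a + b) powr p" using pos by (simp add: add_divide_distrib[symmetric])
    finally show ?thesis .
  qed
  have "(\<integral>s. norm (f s + g s) powr p \<partial>M) powr (1/p) \<le> A + B"
  proof (rule field_le_epsilon)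
    fix e :: real assume e: "e > 0"
    have "(\<integral>s. norm (f s + g s) powr p \<partial>M) powr (1/p) \<le> ((A + e/2 + (B + e/2)) powr p) powr (1/p)"
      using e p by (intro powr_mono2 *) auto
    also have "\<dots> = A + B + e" using e p AB by (simp add: powr_powr)
    finally show "(\<integral>s. norm (f s + g s) powr p \<partial>M) powr (1/p) \<le> A + B + e" .
  qed
  then show ?thesis by (simp add: A_def B_def)
qed

lemma Metric_space_Lp:
  assumes M: "complete_measure M" and p: "1 < p"
  shows "Metric_space (Lp M p :: ('s \<Rightarrow> 'x::real_normed_vector) set set) (Lp_dist M p)"
proof
  have diff: "(\<lambda>s. Lp_rep F s - Lp_rep G s) \<in> Lp_fun M p" if "F \<in> Lp M p" "G \<in> Lp M p" for F G :: "('s \<Rightarrow> 'x) set"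
    using Lp_fun_comb[OF M, of p "Lp_rep F" "Lp_rep G" 1 "-1"] p Lp_rep_in that by auto
  have dist: "Lp_dist M p F G = (\<integral>s. norm (Lp_rep F s - Lp_rep G s) powr p \<partial>M) powr (1/p)"
    if "F \<in> Lp M p" "G \<in> Lp M p" for F G :: "('s \<Rightarrow> 'x) set"
    using Lp_norm_class[OF M diff[OF that]] by (simp add: Lp_dist_def Lp_diff_def)
  fix F G H :: "('s \<Rightarrow> 'x) set"
  show "0 \<le> Lp_dist M p F G" by (simp add: Lp_dist_def Lp_norm_def)
  show "Lp_dist M p F G = Lp_dist M p G F"
  proof (cases "(\<lambda>s. Lp_rep F s - Lp_rep G s) \<in> Lp_fun M p")
    case True
    then have "(\<lambda>s. Lp_rep G s - Lp_rep F s) \<in> Lp_fun M p"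
      using Lp_fun_comb[OF M _ True Lp_fun_zero, of "-1" 1] p by simp
    with True show ?thesis
      by (simp add: Lp_dist_def Lp_diff_def Lp_norm_class[OF M] norm_minus_commute)
  next
    case False
    then have "(\<lambda>s. Lp_rep G s - Lp_rep F s) \<notin> Lp_fun M p"
      using Lp_fun_comb[OF M _ _ Lp_fun_zero, of p "\<lambda>s. Lp_rep G s - Lp_rep F s" "-1" 1] p by auto
    with False have "Lp_diff M p F G = {}" "Lp_diff M p G F = {}"
      by (auto simp: Lp_diff_def Lp_class_def Lp_rel_def)
    then show ?thesis by (simp add: Lp_dist_def)
  qed
  show "(Lp_dist M p F G = 0) = (F = G)" if FG: "F \<in> Lp M p" "G \<in> Lp M p"
  proof -
    have "Lp_dist M p F G = 0 \<longleftrightarrow> (\<integral>s. norm (Lp_rep F s - Lp_rep G s) powr p \<partial>M) = 0"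
      using p by (simp add: dist[OF FG])
    also have "\<dots> \<longleftrightarrow> (AE s in M. norm (Lp_rep F s - Lp_rep G s) powr p = 0)"
      using diff[OF FG] by (intro integral_nonneg_eq_0_iff_AE) (auto simp: Lp_fun_def)
    also have "\<dots> \<longleftrightarrow> (AE s in M. Lp_rep F s = Lp_rep G s)" by simp
    also have "\<dots> \<longleftrightarrow> F = G"
      using Lp_class_eq_iff Lp_rep_in FG by metis
    finally show ?thesis .
  qed
  show "Lp_dist M p F H \<le> Lp_dist M p F G + Lp_dist M p G H"
    if "F \<in> Lp M p" "G \<in> Lp M p" "H \<in> Lp M p"
    using Minkowski_Lp_fun[OF M p diff diff, of F G G H] that by (simp add: dist)
qed

definition Lp_topology :: "'s measure \<Rightarrow> real \<Rightarrow> ('s \<Rightarrow> 'x::real_normed_vector) set topology" where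
  "Lp_topology M p = Metric_space.mtopology (Lp M p) (Lp_dist M p)"

definition Lp_pairing :: "'s measure \<Rightarrow> ('s \<Rightarrow> ('x::real_normed_vector \<Rightarrow>\<^sub>L real)) set \<Rightarrow> ('s \<Rightarrow> 'x) set \<Rightarrow> real" where
  "Lp_pairing M \<phi> F = (\<integral>s. blinfun_apply (Lp_rep \<phi> s) (Lp_rep F s) \<partial>M)"

section \<open>Convex sets, cones and solution sets\<close>

definition Lp_convex :: "'s measure \<Rightarrow> real \<Rightarrow> ('s \<Rightarrow> 'x::real_normed_vector) set set \<Rightarrow> bool" where
  "Lp_convex M p C \<longleftrightarrow>
     (\<forall>f\<in>C. \<forall>g\<in>C. \<forall>a\<ge>0. \<forall>b\<ge>0. a + b = 1 \<longrightarrow> Lp_add M p (Lp_scale M p a f) (Lp_scale M p b g) \<in> C)"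

definition Lp_cone :: "'s measure \<Rightarrow> real \<Rightarrow> ('s \<Rightarrow> 'x::real_normed_vector) set set \<Rightarrow> ('s \<Rightarrow> 'x) set \<Rightarrow> bool" where
  "Lp_cone M p K v \<longleftrightarrow> K \<subseteq> Lp M p \<and> v \<in> K \<and>
     (\<forall>g\<in>K. \<forall>t\<ge>0. Lp_add M p v (Lp_scale M p t (Lp_diff M p g v)) \<in> K)"

text \<open>The supremum is taken in the extended reals, as the pairing may be unbounded above on \<open>C\<close>.\<close>

definition solution_set ::
    "'s measure \<Rightarrow> ('s \<Rightarrow> 'x::real_normed_vector) set set \<Rightarrow> ('s \<Rightarrow> ('x \<Rightarrow>\<^sub>L real)) set \<Rightarrow> ('s \<Rightarrow> 'x) set set" where
  "solution_set M C \<phi> = {g \<in> C. ereal (Lp_pairing M \<phi> g) = (SUP f\<in>C. ereal (Lp_pairing M \<phi> f))}"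

definition Lp_orth :: "'s measure \<Rightarrow> ('s \<Rightarrow> ('x::real_normed_vector \<Rightarrow>\<^sub>L real)) set \<Rightarrow> ('s \<Rightarrow> 'x) set \<Rightarrow> bool" where
  "Lp_orth M \<phi> f \<longleftrightarrow> Lp_pairing M \<phi> f = 0"

definition Lp_orth_set :: "'s measure \<Rightarrow> ('s \<Rightarrow> ('x::real_normed_vector \<Rightarrow>\<^sub>L real)) set \<Rightarrow> ('s \<Rightarrow> 'x) set set \<Rightarrow> bool" where
  "Lp_orth_set M \<phi> A \<longleftrightarrow> (\<forall>f\<in>A. Lp_orth M \<phi> f)"

definition Lp_translate :: "'s measure \<Rightarrow> real \<Rightarrow> ('s \<Rightarrow> 'x::real_normed_vector) set set \<Rightarrow> ('s \<Rightarrow> 'x) set \<Rightarrow> ('s \<Rightarrow> 'x) set set" where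
  "Lp_translate M p A v = (\<lambda>f. Lp_diff M p f v) ` A"

end

theory Submission
  imports Defs
begin

text \<open>
  For a fixed functional \<open>\<phi>\<close> the pairing \<open>F \<mapsto> \<langle>\<phi>, F\<rangle>\<close> is a continuous linear functional, and
  everything is a consequence of how such a functional behaves on a ray. If \<open>g\<close> maximises it over
  the cone \<open>K\<close>, then the whole ray \<open>v + t (g - v)\<close> stays in \<open>K\<close>, and the pairing is affine in \<open>t\<close>
  with slope \<open>\<langle>\<phi>, g - v\<rangle>\<close>. The maximum is attained at \<open>t = 1\<close>, a point with neighbours on both
  sides, so the slope is zero (\<open>solution_pairing_eq_vertex\<close>). Hence every solution pairs with \<open>\<phi>\<close>
  as the vertex does, the vertex is itself a solution, and a nonempty solution set is exactly the
  slice \<open>{g \<in> K. \<langle>\<phi>, g\<rangle> = \<langle>\<phi>, v\<rangle>}\<close> of \<open>K\<close> (\<open>solution_set_eq_slice\<close>). The slice inherits from \<open>K\<close>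
  convexity and the cone property, because the slicing condition is affine, and closedness,
  because the condition is continuous (\<open>closedin_pairing_level\<close>).

  The analytic content is that the pairing really is linear and continuous on classes. Both facts
  come from Young's inequality, which bounds \<open>\<phi>(s)(f(s))\<close> by an integrable function.
\<close>

section \<open>The pairing as a continuous linear functional\<close>

lemma strongly_measurable_real_measurable:
  fixes f :: "'s \<Rightarrow> real"
  assumes "complete_measure M" "strongly_measurable M f"
  shows "f \<in> borel_measurable M"
proof -
  from assms obtain u where
    u: "\<And>n. simple_function M (u n)" "AE s in M. (\<lambda>n. u n s) \<longlonglongrightarrow> f s"
    unfolding strongly_measurable_def by blast
  have [measurable]: "u n \<in> borel_measurable M" for n
    by (intro borel_measurable_simple_function u(1))
  have "(\<lambda>s. lim (\<lambda>n. u n s)) \<in> borel_measurable M"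
    by measurable
  moreover have "AE s in M. lim (\<lambda>n. u n s) = f s"
    using u(2) by eventually_elim (rule limI)
  ultimately show ?thesis by (rule borel_measurable_AE_complete[OF assms(1)])
qed

locale conjugate_exponents =
  fixes M :: "'s measure" and p q :: real
  assumes complete: "complete_measure M"
    and p: "1 < p" and q: "1 < q" and conj: "1 / p + 1 / q = 1"
begin

lemma pointwise_pairing_bound:
  fixes a :: "'x::real_normed_vector \<Rightarrow>\<^sub>L real"
  shows "\<bar>blinfun_apply a x\<bar> \<le> norm x powr p / p + norm a powr q / q"
proof -
  have "\<bar>blinfun_apply a x\<bar> \<le> norm x * norm a"
    using norm_blinfun[of a x] by (simp add: mult.commute)
  also have "\<dots> \<le> norm x powr p / p + norm a powr q / q"
    using p q conj by (intro Youngs_inequality) auto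
  finally show ?thesis .
qed

lemma pairing_measurable:
  fixes h :: "'s \<Rightarrow> ('x::real_normed_vector \<Rightarrow>\<^sub>L real)"
  assumes "h \<in> Lp_fun M q" "f \<in> Lp_fun M p"
  shows "(\<lambda>s. blinfun_apply (h s) (f s)) \<in> borel_measurable M"
  using assms
  by (intro strongly_measurable_real_measurable[OF complete]
      strongly_measurable_compose2[where h = blinfun_apply])
    (auto simp: Lp_fun_def intro!: continuous_intros)

lemma pairing_integrable:
  fixes h :: "'s \<Rightarrow> ('x::real_normed_vector \<Rightarrow>\<^sub>L real)"
  assumes "h \<in> Lp_fun M q" "f \<in> Lp_fun M p"
  shows "integrable M (\<lambda>s. blinfun_apply (h s) (f s))"
proof (rule Bochner_Integration.integrable_bound)
  show "integrable M (\<lambda>s. norm (f s) powr p / p + norm (h s) powr q / q)"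
    using assms by (auto simp: Lp_fun_def)
  show "AE s in M. norm (blinfun_apply (h s) (f s))
      \<le> norm (norm (f s) powr p / p + norm (h s) powr q / q)"
    using pointwise_pairing_bound p q by (intro AE_I2) simp
qed (rule pairing_measurable[OF assms])

lemma Lp_pairing_class:
  assumes "\<phi> \<in> Lp M q" "f \<in> Lp_fun M p"
  shows "Lp_pairing M \<phi> (Lp_class M p f) = (\<integral>s. blinfun_apply (Lp_rep \<phi> s) (f s) \<partial>M)"
  unfolding Lp_pairing_def
proof (rule integral_cong_AE)
  show "AE s in M. blinfun_apply (Lp_rep \<phi> s) (Lp_rep (Lp_class M p f) s)
      = blinfun_apply (Lp_rep \<phi> s) (f s)"
    using AE_Lp_rep_class[OF assms(2)] by eventually_elim simp
qed (auto intro!: pairing_measurable Lp_rep_in(1) Lp_class_in assms)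

lemma Lp_rep_comb:
  assumes "F \<in> Lp M p" "G \<in> Lp M p"
  shows "(\<lambda>s. a *\<^sub>R Lp_rep F s + b *\<^sub>R Lp_rep G s) \<in> Lp_fun M p"
  using p assms by (intro Lp_fun_comb[OF complete] Lp_rep_in(1)) auto

lemma Lp_pairing_comb:
  assumes "\<phi> \<in> Lp M q" "F \<in> Lp M p" "G \<in> Lp M p"
  shows "Lp_pairing M \<phi> (Lp_class M p (\<lambda>s. a *\<^sub>R Lp_rep F s + b *\<^sub>R Lp_rep G s))
    = a * Lp_pairing M \<phi> F + b * Lp_pairing M \<phi> G"
proof -
  have "integrable M (\<lambda>s. blinfun_apply (Lp_rep \<phi> s) (Lp_rep H s))" if "H \<in> Lp M p" for H
    using assms(1) that by (intro pairing_integrable Lp_rep_in(1))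
  then show ?thesis
    unfolding Lp_pairing_class[OF assms(1) Lp_rep_comb[OF assms(2,3)]]
    using assms by (simp add: Lp_pairing_def blinfun.add_right blinfun.scaleR_right)
qed

lemma Lp_diff_in: "F \<in> Lp M p \<Longrightarrow> G \<in> Lp M p \<Longrightarrow> Lp_diff M p F G \<in> Lp M p"
  using Lp_class_in[OF Lp_rep_comb, of F G 1 "-1"] by (simp add: Lp_diff_def)

lemma Lp_scale_in: "F \<in> Lp M p \<Longrightarrow> Lp_scale M p t F \<in> Lp M p"
  using Lp_class_in[OF Lp_rep_comb, of F F t 0] by (simp add: Lp_scale_def)

lemma Lp_pairing_add:
  "\<phi> \<in> Lp M q \<Longrightarrow> F \<in> Lp M p \<Longrightarrow> G \<in> Lp M p \<Longrightarrow>
    Lp_pairing M \<phi> (Lp_add M p F G) = Lp_pairing M \<phi> F + Lp_pairing M \<phi> G"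
  using Lp_pairing_comb[of \<phi> F G 1 1] by (simp add: Lp_add_def)

lemma Lp_pairing_diff:
  "\<phi> \<in> Lp M q \<Longrightarrow> F \<in> Lp M p \<Longrightarrow> G \<in> Lp M p \<Longrightarrow>
    Lp_pairing M \<phi> (Lp_diff M p F G) = Lp_pairing M \<phi> F - Lp_pairing M \<phi> G"
  using Lp_pairing_comb[of \<phi> F G 1 "-1"] by (simp add: Lp_diff_def)

lemma Lp_pairing_scale:
  "\<phi> \<in> Lp M q \<Longrightarrow> F \<in> Lp M p \<Longrightarrow> Lp_pairing M \<phi> (Lp_scale M p t F) = t * Lp_pairing M \<phi> F"
  using Lp_pairing_comb[of \<phi> F F t 0] by (simp add: Lp_scale_def)

lemma Lp_pairing_zero: "\<phi> \<in> Lp M q \<Longrightarrow> Lp_pairing M \<phi> (Lp_zero M p) = 0"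
  using p by (simp add: Lp_zero_def Lp_pairing_class Lp_fun_zero)

text \<open>Boundedness of the pairing, in the form used for continuity: Young's inequality applied to
  \<open>F / r\<close>, whose norm is below 1, bounds the pairing by a constant times \<open>r\<close>. Stating it for all
  \<open>r\<close> above the norm avoids a separate treatment of \<open>F = 0\<close>.\<close>

lemma Lp_pairing_bound:
  assumes \<phi>: "\<phi> \<in> Lp M q" and F: "F \<in> Lp M p" and r: "Lp_norm M p F < r"
  shows "\<bar>Lp_pairing M \<phi> F\<bar> \<le> (1 / p + (\<integral>s. norm (Lp_rep \<phi> s) powr q \<partial>M) / q) * r"
proof -
  define A where "A = (\<integral>s. norm (Lp_rep F s) powr p \<partial>M)"
  define B where "B = (\<integral>s. norm (Lp_rep \<phi> s) powr q \<partial>M)"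
  have r0: "r > 0" using r by (simp add: Lp_norm_def) (smt (verit) powr_ge_zero)
  have "A = (A powr (1 / p)) powr p"
    using p by (simp add: A_def powr_powr)
  also have "\<dots> \<le> r powr p"
    using r p by (intro powr_mono2) (auto simp: A_def Lp_norm_def)
  finally have "A \<le> r powr p" .
  then have A: "A / r powr p \<le> 1" using r0 by simp
  have int: "integrable M (\<lambda>s. norm (Lp_rep F s) powr p)"
      "integrable M (\<lambda>s. norm (Lp_rep \<phi> s) powr q)"
    using Lp_rep_in(1)[OF F] Lp_rep_in(1)[OF \<phi>] by (auto simp: Lp_fun_def)
  have pt: "\<bar>blinfun_apply a x\<bar> \<le> r * (norm x powr p / r powr p / p + norm a powr q / q)"
    for a :: "'a \<Rightarrow>\<^sub>L real" and x
  proof -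
    have "\<bar>blinfun_apply a x\<bar> = r * \<bar>blinfun_apply a ((1 / r) *\<^sub>R x)\<bar>"
      using r0 by (simp add: blinfun.scaleR_right abs_mult)
    also have "\<dots> \<le> r * (norm ((1 / r) *\<^sub>R x) powr p / p + norm a powr q / q)"
      using r0 by (intro mult_left_mono pointwise_pairing_bound) auto
    finally show ?thesis using r0 by (simp add: powr_divide)
  qed
  have "\<bar>Lp_pairing M \<phi> F\<bar> \<le> (\<integral>s. \<bar>blinfun_apply (Lp_rep \<phi> s) (Lp_rep F s)\<bar> \<partial>M)"
    unfolding Lp_pairing_def by (rule integral_abs_bound)
  also have "\<dots> \<le> (\<integral>s. r * (norm (Lp_rep F s) powr p / r powr p / p
      + norm (Lp_rep \<phi> s) powr q / q) \<partial>M)"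
    using int pt \<phi> F
    by (intro integral_mono integrable_abs pairing_integrable Lp_rep_in(1)) auto
  also have "\<dots> = r * (A / r powr p / p + B / q)"
    using int by (simp add: A_def B_def)
  also have "\<dots> \<le> r * (1 / p + B / q)"
    using A r0 p q by (intro mult_left_mono add_mono divide_right_mono) auto
  finally show ?thesis by (simp add: B_def mult.commute)
qed

lemma closedin_pairing_level:
  fixes \<phi> :: "('s \<Rightarrow> ('x::real_normed_vector \<Rightarrow>\<^sub>L real)) set"
  assumes \<phi>: "\<phi> \<in> Lp M q"
  shows "closedin (Lp_topology M p) {F \<in> Lp M p. Lp_pairing M \<phi> F = c}"
proof -
  interpret Metric_space "Lp M p :: ('s \<Rightarrow> 'x) set set" "Lp_dist M p"
    by (rule Metric_space_Lp[OF complete p])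
  define C where "C = 1 / p + (\<integral>s. norm (Lp_rep \<phi> s) powr q \<partial>M) / q"
  have C: "C \<ge> 0" using p q by (auto simp: C_def intro!: add_nonneg_nonneg)
  have "\<exists>r>0. disjnt {F \<in> Lp M p. Lp_pairing M \<phi> F = c} (mball G r)"
    if G: "G \<in> Lp M p" and ne: "Lp_pairing M \<phi> G \<noteq> c" for G
  proof -
    define d where "d = \<bar>Lp_pairing M \<phi> G - c\<bar>"
    \<comment> \<open>On a ball of radius \<open>r\<close> the pairing varies by at most \<open>C r\<close>, which this choice keeps below \<open>d\<close>.\<close>
    define r where "r = d / (C + 1)"
    have d: "d > 0" using ne by (simp add: d_def)
    have r: "r > 0" using d C by (simp add: r_def)
    have Cr: "C * r < d" using d C by (simp add: r_def field_simps)
    have "Lp_pairing M \<phi> F \<noteq> c" if F: "F \<in> Lp M p" "Lp_dist M p G F < r" for F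
    proof -
      have "\<bar>Lp_pairing M \<phi> (Lp_diff M p G F)\<bar> \<le> C * r"
        unfolding C_def using F G
        by (intro Lp_pairing_bound \<phi> Lp_diff_in) (auto simp: Lp_dist_def)
      with Cr show ?thesis
        using F G by (auto simp: Lp_pairing_diff[OF \<phi>] d_def)
    qed
    with r show ?thesis by (auto simp: disjnt_iff)
  qed
  then show ?thesis
    unfolding Lp_topology_def closedin_metric by auto
qed

end

section \<open>Maximising the pairing over a cone\<close>

lemma mem_solution_set_iff:
  "g \<in> solution_set M C \<phi> \<longleftrightarrow> g \<in> C \<and> (\<forall>f\<in>C. Lp_pairing M \<phi> f \<le> Lp_pairing M \<phi> g)"
proof -
  have "ereal (Lp_pairing M \<phi> g) = (SUP f\<in>C. ereal (Lp_pairing M \<phi> f)) \<longleftrightarrow>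
      (\<forall>f\<in>C. Lp_pairing M \<phi> f \<le> Lp_pairing M \<phi> g)" if "g \<in> C"
  proof
    assume eq: "ereal (Lp_pairing M \<phi> g) = (SUP f\<in>C. ereal (Lp_pairing M \<phi> f))"
    show "\<forall>f\<in>C. Lp_pairing M \<phi> f \<le> Lp_pairing M \<phi> g"
    proof
      fix f assume "f \<in> C"
      then have "ereal (Lp_pairing M \<phi> f) \<le> (SUP f\<in>C. ereal (Lp_pairing M \<phi> f))"
        by (rule SUP_upper)
      then show "Lp_pairing M \<phi> f \<le> Lp_pairing M \<phi> g" by (simp flip: eq)
    qed
  next
    assume "\<forall>f\<in>C. Lp_pairing M \<phi> f \<le> Lp_pairing M \<phi> g"
    with that show "ereal (Lp_pairing M \<phi> g) = (SUP f\<in>C. ereal (Lp_pairing M \<phi> f))"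
      by (intro antisym SUP_upper SUP_least) auto
  qed
  then show ?thesis by (auto simp: solution_set_def)
qed

lemma Lp_coneD:
  assumes "Lp_cone M p K v"
  shows "K \<subseteq> Lp M p" "v \<in> K"
    and "g \<in> K \<Longrightarrow> 0 \<le> t \<Longrightarrow> Lp_add M p v (Lp_scale M p t (Lp_diff M p g v)) \<in> K"
  using assms by (simp_all add: Lp_cone_def)

context conjugate_exponents
begin

lemma Lp_pairing_ray:
  assumes "\<phi> \<in> Lp M q" "v \<in> Lp M p" "g \<in> Lp M p"
  shows "Lp_pairing M \<phi> (Lp_add M p v (Lp_scale M p t (Lp_diff M p g v)))
    = Lp_pairing M \<phi> v + t * (Lp_pairing M \<phi> g - Lp_pairing M \<phi> v)"
  using assms by (simp add: Lp_pairing_add Lp_pairing_scale Lp_pairing_diff Lp_diff_in Lp_scale_in)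

text \<open>The pairing is affine along the ray from \<open>v\<close> through \<open>g\<close> and maximal at \<open>g\<close>. Comparison with
  the vertex shows that it does not decrease along the ray, and comparison with the point at
  \<open>t = 2\<close> beyond \<open>g\<close> shows that it does not increase.\<close>

lemma solution_pairing_eq_vertex:
  assumes \<phi>: "\<phi> \<in> Lp M q" and K: "Lp_cone M p K v" and g: "g \<in> solution_set M K \<phi>"
  shows "Lp_pairing M \<phi> g = Lp_pairing M \<phi> v"
proof -
  have vK: "v \<in> K" and gK: "g \<in> K" and L: "v \<in> Lp M p" "g \<in> Lp M p"
    and max: "\<And>f. f \<in> K \<Longrightarrow> Lp_pairing M \<phi> f \<le> Lp_pairing M \<phi> g"
    using Lp_coneD(1,2)[OF K] g by (auto simp: mem_solution_set_iff)
  have "Lp_add M p v (Lp_scale M p 2 (Lp_diff M p g v)) \<in> K"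
    using Lp_coneD(3)[OF K gK] by simp
  from max[OF this] max[OF vK] show ?thesis
    by (simp add: Lp_pairing_ray[OF \<phi> L])
qed

lemma solution_set_eq_slice:
  assumes \<phi>: "\<phi> \<in> Lp M q" and K: "Lp_cone M p K v" and ne: "solution_set M K \<phi> \<noteq> {}"
  shows "solution_set M K \<phi> = {g \<in> K. Lp_pairing M \<phi> g = Lp_pairing M \<phi> v}"
proof -
  obtain g where g: "g \<in> solution_set M K \<phi>" using ne by blast
  have max: "Lp_pairing M \<phi> f \<le> Lp_pairing M \<phi> v" if "f \<in> K" for f
    using g that solution_pairing_eq_vertex[OF \<phi> K g] by (simp add: mem_solution_set_iff)
  show ?thesis
  proof (intro equalityI subsetI)
    fix f assume f: "f \<in> solution_set M K \<phi>"
    then have "f \<in> K" by (simp add: mem_solution_set_iff)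
    with solution_pairing_eq_vertex[OF \<phi> K f]
    show "f \<in> {g \<in> K. Lp_pairing M \<phi> g = Lp_pairing M \<phi> v}" by simp
  next
    fix f assume "f \<in> {g \<in> K. Lp_pairing M \<phi> g = Lp_pairing M \<phi> v}"
    with max show "f \<in> solution_set M K \<phi>" by (simp add: mem_solution_set_iff)
  qed
qed

lemma vertex_in_solution_set:
  assumes "\<phi> \<in> Lp M q" "Lp_cone M p K v" "solution_set M K \<phi> \<noteq> {}"
  shows "v \<in> solution_set M K \<phi>"
  using solution_set_eq_slice[OF assms] assms(2) by (simp add: Lp_cone_def)

lemma closedin_solution_set:
  assumes \<phi>: "\<phi> \<in> Lp M q" and K: "Lp_cone M p K v" and ne: "solution_set M K \<phi> \<noteq> {}"
    and cl: "closedin (Lp_topology M p) K"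
  shows "closedin (Lp_topology M p) (solution_set M K \<phi>)"
proof -
  have "solution_set M K \<phi> = K \<inter> {F \<in> Lp M p. Lp_pairing M \<phi> F = Lp_pairing M \<phi> v}"
    using Lp_coneD(1)[OF K] by (auto simp: solution_set_eq_slice[OF \<phi> K ne])
  then show ?thesis using cl closedin_pairing_level[OF \<phi>] by (simp add: closedin_Int)
qed

lemma Lp_convex_solution_set:
  assumes \<phi>: "\<phi> \<in> Lp M q" and K: "Lp_cone M p K v" and ne: "solution_set M K \<phi> \<noteq> {}"
    and conv: "Lp_convex M p K"
  shows "Lp_convex M p (solution_set M K \<phi>)"
  unfolding Lp_convex_def solution_set_eq_slice[OF \<phi> K ne]
proof (intro ballI allI impI CollectI conjI; clarify)
  fix f g and a b :: real
  assume fg: "f \<in> K" "g \<in> K" and ab: "0 \<le> a" "0 \<le> b" "a + b = 1"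
    and eq: "Lp_pairing M \<phi> f = Lp_pairing M \<phi> v" "Lp_pairing M \<phi> g = Lp_pairing M \<phi> v"
  show "Lp_add M p (Lp_scale M p a f) (Lp_scale M p b g) \<in> K"
    using conv fg ab by (simp add: Lp_convex_def)
  have "f \<in> Lp M p" "g \<in> Lp M p" using Lp_coneD(1)[OF K] fg by auto
  then have "Lp_pairing M \<phi> (Lp_add M p (Lp_scale M p a f) (Lp_scale M p b g))
      = (a + b) * Lp_pairing M \<phi> v"
    by (simp add: Lp_pairing_add Lp_pairing_scale Lp_scale_in \<phi> eq distrib_right)
  then show "Lp_pairing M \<phi> (Lp_add M p (Lp_scale M p a f) (Lp_scale M p b g)) = Lp_pairing M \<phi> v"
    by (simp add: ab)
qed

lemma Lp_cone_solution_set: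
  assumes \<phi>: "\<phi> \<in> Lp M q" and K: "Lp_cone M p K v" and ne: "solution_set M K \<phi> \<noteq> {}"
  shows "Lp_cone M p (solution_set M K \<phi>) v"
  unfolding Lp_cone_def solution_set_eq_slice[OF \<phi> K ne]
proof (intro conjI ballI allI impI)
  note KL = Lp_coneD(1,2)[OF K]
  show "{g \<in> K. Lp_pairing M \<phi> g = Lp_pairing M \<phi> v} \<subseteq> Lp M p"
    and "v \<in> {g \<in> K. Lp_pairing M \<phi> g = Lp_pairing M \<phi> v}"
    using KL by auto
  fix g and t :: real
  assume "g \<in> {g \<in> K. Lp_pairing M \<phi> g = Lp_pairing M \<phi> v}" and "0 \<le> t"
  then show "Lp_add M p v (Lp_scale M p t (Lp_diff M p g v))
      \<in> {g \<in> K. Lp_pairing M \<phi> g = Lp_pairing M \<phi> v}"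
    using KL Lp_coneD(3)[OF K] Lp_pairing_ray[OF \<phi>, of v g t] by (simp add: subset_iff)
qed

end

theorem theorem4p1:
  fixes M :: "'s measure"
    and p q :: real
    and K :: "('s \<Rightarrow> 'x::banach) set set"
    and v :: "('s \<Rightarrow> 'x) set"
    and \<phi> :: "('s \<Rightarrow> ('x \<Rightarrow>\<^sub>L real)) set"
  assumes "complete_measure M"
    and "uniformly_convex TYPE('x)"
    and "uniformly_smooth TYPE('x)"
    and "1 < p" and "1 < q" and "1 / p + 1 / q = 1"
    and "v \<in> Lp M p"
    and "closedin (Lp_topology M p) K"
    and "Lp_convex M p K"
    and "Lp_cone M p K v"
    and "\<phi> \<in> Lp M q"
  shows
    "(\<forall>g \<in> solution_set M K \<phi>.
        Lp_orth M \<phi> (Lp_diff M p g v) \<and> Lp_pairing M \<phi> g = Lp_pairing M \<phi> v)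
     \<and> (solution_set M K \<phi> \<noteq> {} \<longrightarrow> v \<in> solution_set M K \<phi>)
     \<and> ((\<exists>g \<in> solution_set M K \<phi>. g \<noteq> v) \<longrightarrow>
          closedin (Lp_topology M p) (solution_set M K \<phi>) \<and>
          Lp_convex M p (solution_set M K \<phi>) \<and>
          Lp_cone M p (solution_set M K \<phi>) v \<and>
          solution_set M K \<phi> \<subseteq> K)
     \<and> (solution_set M K \<phi> \<noteq> {} \<longrightarrow>
          Lp_orth_set M \<phi> (Lp_translate M p (solution_set M K \<phi>) v))
     \<and> (v = Lp_zero M p \<longrightarrow>
          (\<forall>\<psi> \<in> Lp M q. solution_set M K \<psi> \<noteq> {} \<longrightarrow> Lp_orth_set M \<psi> (solution_set M K \<psi>)))
     \<and> (\<Inter> {solution_set M K \<psi> |\<psi>. \<psi> \<in> Lp M q \<and> solution_set M K \<psi> \<noteq> {}} \<noteq> {})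
     \<and> v \<in> \<Inter> {solution_set M K \<psi> |\<psi>. \<psi> \<in> Lp M q \<and> solution_set M K \<psi> \<noteq> {}}"
proof -
  interpret conjugate_exponents M p q
    using assms(1,4,5,6) by (rule conjugate_exponents.intro)
  note K = \<open>Lp_cone M p K v\<close> and \<phi> = \<open>\<phi> \<in> Lp M q\<close>
  have KL: "K \<subseteq> Lp M p" by (rule Lp_coneD(1)[OF K])
  have sub: "solution_set M K \<psi> \<subseteq> K" for \<psi> by (auto simp: solution_set_def)
  have pair: "Lp_pairing M \<phi> g = Lp_pairing M \<phi> v" if "g \<in> solution_set M K \<phi>" for g
    by (rule solution_pairing_eq_vertex[OF \<phi> K that])
  have orth: "Lp_orth M \<phi> (Lp_diff M p g v)" if "g \<in> solution_set M K \<phi>" for g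
  proof -
    have "g \<in> Lp M p" using that sub[of \<phi>] KL by blast
    with pair[OF that] \<open>v \<in> Lp M p\<close> show ?thesis
      by (simp add: Lp_orth_def Lp_pairing_diff[OF \<phi>])
  qed
  have zero: "Lp_orth_set M \<psi> (solution_set M K \<psi>)" if "v = Lp_zero M p" "\<psi> \<in> Lp M q" for \<psi>
    unfolding Lp_orth_set_def Lp_orth_def
  proof
    fix f assume "f \<in> solution_set M K \<psi>"
    from solution_pairing_eq_vertex[OF that(2) K this] that
    show "Lp_pairing M \<psi> f = 0" by (simp add: Lp_pairing_zero)
  qed
  have common: "v \<in> \<Inter> {solution_set M K \<psi> |\<psi>. \<psi> \<in> Lp M q \<and> solution_set M K \<psi> \<noteq> {}}"
    using vertex_in_solution_set[OF _ K] by auto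
  show ?thesis
  proof (intro conjI ballI impI)
    assume "\<exists>g \<in> solution_set M K \<phi>. g \<noteq> v"
    then have ne: "solution_set M K \<phi> \<noteq> {}" by blast
    show "closedin (Lp_topology M p) (solution_set M K \<phi>)"
      by (rule closedin_solution_set[OF \<phi> K ne assms(8)])
    show "Lp_convex M p (solution_set M K \<phi>)"
      by (rule Lp_convex_solution_set[OF \<phi> K ne assms(9)])
    show "Lp_cone M p (solution_set M K \<phi>) v"
      by (rule Lp_cone_solution_set[OF \<phi> K ne])
    show "solution_set M K \<phi> \<subseteq> K" by (rule sub)
  next
    show "Lp_orth_set M \<phi> (Lp_translate M p (solution_set M K \<phi>) v)"
      using orth by (auto simp: Lp_orth_set_def Lp_translate_def)
  next
    show "\<Inter> {solution_set M K \<psi> |\<psi>. \<psi> \<in> Lp M q \<and> solution_set M K \<psi> \<noteq> {}} \<noteq> {}"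
      using common by blast
  qed (assumption | rule pair orth zero vertex_in_solution_set[OF \<phi> K] common)+
qed

end
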